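(* Let $G$ be a graph with $m\ge 1$ edges and minimum degree $\delta$, and let $\alpha>0$ be real. Then $$SDD_{\alpha}(G)\ge\frac{\delta^{\alpha}m^2}{ISD_{-\alpha}(G)},$$ and equality is attained if and only if $G$ is regular.
   Context: Graphs are finite, simple and undirected. For a graph $G$ with edge set $E(G)$, $d_u$ denotes the degree of the vertex $u$, and $uv$ denotes the edge joining $u$ and $v$. For $\alpha\in\mathbb{R}$, the variable symmetric division deg index is $$SDD_\alpha(G)=\sum_{uv\in E(G)}\left(\frac{d_u^\alpha}{d_v^\alpha}+\frac{d_v^\alpha}{d_u^\alpha}\right).$$ For $a\in\mathbb{R}$, the variable inverse sum deg index is $$ISD_a(G)=\sum_{uv\in E(G)}\frac{1}{d_u^a+d_v^a}.$$ A graph is regular if all its vertices have the same degree. *)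

theory Defs
  imports Complex_Main
begin

locale simple_graph =
  fixes V :: "'v set" and E :: "'v set set"
  assumes finite_vertices: "finite V"
    and edges: "\<And>e. e \<in> E \<Longrightarrow> e \<subseteq> V \<and> card e = 2"

definition degree :: "'v set set \<Rightarrow> 'v \<Rightarrow> nat" where
  "degree E v = card {e \<in> E. v \<in> e}"

definition min_degree :: "'v set \<Rightarrow> 'v set set \<Rightarrow> nat" where
  "min_degree V E = Min (degree E ` V)"

definition regular :: "'v set \<Rightarrow> 'v set set \<Rightarrow> bool" where
  "regular V E \<longleftrightarrow> (\<forall>u\<in>V. \<forall>v\<in>V. degree E u = degree E v)"

(* The value f u v at the unordered edge {u, v}. It is meant only for symmetric f,
   for which it does not depend on the order of the ends (edge_value_pair). *)
definition edge_value :: "('v \<Rightarrow> 'v \<Rightarrow> real) \<Rightarrow> 'v set \<Rightarrow> real" where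
  "edge_value f e = (THE r. \<exists>u v. e = {u, v} \<and> r = f u v)"

lemma edge_value_pair:
  assumes "\<And>x y. f x y = f y x"
  shows "edge_value f {u, v} = f u v"
  unfolding edge_value_def
proof (rule the_equality)
  show "\<exists>x y. {u, v} = {x, y} \<and> f u v = f x y" by blast
next
  fix r assume "\<exists>x y. {u, v} = {x, y} \<and> r = f x y"
  then show "r = f u v" using assms by (auto simp: doubleton_eq_iff)
qed

definition SDD :: "real \<Rightarrow> 'v set set \<Rightarrow> real" where
  "SDD \<alpha> E = (\<Sum>e\<in>E. edge_value
     (\<lambda>u v. real (degree E u) powr \<alpha> / real (degree E v) powr \<alpha>
          + real (degree E v) powr \<alpha> / real (degree E u) powr \<alpha>) e)"

definition ISD :: "real \<Rightarrow> 'v set set \<Rightarrow> real" where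
  "ISD a E = (\<Sum>e\<in>E. edge_value
     (\<lambda>u v. 1 / (real (degree E u) powr a + real (degree E v) powr a)) e)"

end

theory Submission
  imports Defs
begin

text \<open>
  For an edge with \<open>x = d\<^sub>u\<^sup>\<alpha>\<close> and \<open>y = d\<^sub>v\<^sup>\<alpha>\<close>, the summand \<open>x/y + y/x\<close> of \<open>SDD\<^sub>\<alpha>\<close> times the
  summand \<open>1/(1/x + 1/y)\<close> of \<open>ISD\<^sub>-\<^sub>\<alpha>\<close> is \<open>(x\<^sup>2 + y\<^sup>2)/(x + y) \<ge> (x + y)/2 \<ge> \<delta>\<^sup>\<alpha>\<close>, with equality
  only for \<open>x = y = \<delta>\<^sup>\<alpha>\<close>. The Cauchy-Schwarz inequality then bounds the product of the two sums.
  An isolated vertex makes the bound 0, while \<open>SDD\<^sub>\<alpha> > 0\<close>; otherwise equality forces degree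
  \<open>\<delta>\<close> at both ends of every edge, hence at every vertex.
\<close>

text \<open>This is Cauchy-Schwarz in tangent-line form: \<open>f e\<close> is at least
  \<open>D / g e\<close>, which lies above \<open>D\<close> times a tangent to \<open>1 / b\<close>,
  and the tangent values sum exactly to the bound. Equal sums then force equality in every
  term.\<close>

lemma sum_ge_card_squared_div_sum:
  fixes f g :: "'a \<Rightarrow> real"
  assumes "finite S" and "S \<noteq> {}"
    and g_pos: "\<And>e. e \<in> S \<Longrightarrow> 0 < g e"
    and "0 \<le> D" and fg: "\<And>e. e \<in> S \<Longrightarrow> D \<le> f e * g e"
  shows "D * (real (card S))\<^sup>2 / sum g S \<le> sum f S"
    and "sum f S = D * (real (card S))\<^sup>2 / sum g S \<Longrightarrow> \<forall>e\<in>S. f e * g e = D"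
proof -
  \<comment> \<open>The reciprocal of the mean of \<open>g\<close> over \<open>S\<close>. This
    choice maximises \<open>2 * t * card S - t\<^sup>2 * sum g S\<close>, so the tangents give the
    best bound.\<close>
  define t where "t = real (card S) / sum g S"
  have "0 < sum g S"
    using assms by (intro sum_pos) auto
  have "(\<Sum>e\<in>S. D * (2 * t - t\<^sup>2 * g e)) = D * (2 * t * real (card S) - t\<^sup>2 * sum g S)"
    by (simp add: sum_distrib_left[symmetric] sum_subtractf)
  also have "\<dots> = D * (real (card S))\<^sup>2 / sum g S"
    using \<open>0 < sum g S\<close> by (simp add: t_def field_simps power2_eq_square)
  finally have tangent_sum:
    "(\<Sum>e\<in>S. D * (2 * t - t\<^sup>2 * g e)) = D * (real (card S))\<^sup>2 / sum g S" .
  \<comment> \<open>\<open>2 * t - t\<^sup>2 * b\<close> is the tangent at \<open>b = 1 / t\<close> to the convex function \<open>1 / b\<close>.\<close>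
  have tangent: "D * (2 * t - t\<^sup>2 * g e) \<le> D / g e" if "e \<in> S" for e
  proof -
    have "0 \<le> (t * g e - 1)\<^sup>2" by simp
    then have "2 * t - t\<^sup>2 * g e \<le> 1 / g e"
      using g_pos[OF that] by (simp add: field_simps power2_eq_square)
    then show ?thesis
      using mult_left_mono[OF _ \<open>0 \<le> D\<close>, of "2 * t - t\<^sup>2 * g e" "1 / g e"] by simp
  qed
  have le: "D / g e \<le> f e" if "e \<in> S" for e
    using fg[OF that] g_pos[OF that] by (simp add: field_simps)
  show "D * (real (card S))\<^sup>2 / sum g S \<le> sum f S"
    unfolding tangent_sum[symmetric] by (intro sum_mono) (meson tangent le order_trans)
  show "\<forall>e\<in>S. f e * g e = D" if eq: "sum f S = D * (real (card S))\<^sup>2 / sum g S"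
  proof
    fix e assume e: "e \<in> S"
    have "D * (2 * t - t\<^sup>2 * g e) = f e"
      by (rule sum_mono_inv[OF _ _ e \<open>finite S\<close>])
        (use eq tangent_sum tangent le in \<open>auto intro: order_trans\<close>)
    \<comment> \<open>\<open>D / g e\<close> is squeezed between the tangent value and
      \<open>f e\<close>, which now coincide.\<close>
    then have "f e = D / g e"
      using tangent[OF e] le[OF e] by simp
    then show "f e * g e = D"
      using g_pos[OF e] by simp
  qed
qed

lemma edge_term_product_bound:
  fixes x y D :: real
  assumes "0 < x" "0 < y" "D \<le> x" "D \<le> y"
  shows "D \<le> (x / y + y / x) * (1 / (1 / x + 1 / y))"
    and "(x / y + y / x) * (1 / (1 / x + 1 / y)) = D \<Longrightarrow> x = D \<and> y = D"
proof -
  define q where "q = (x / y + y / x) * (1 / (1 / x + 1 / y))"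
  have "q = (x\<^sup>2 + y\<^sup>2) / (x + y)"
    using assms by (simp add: q_def divide_simps power2_eq_square)
  moreover have "x + y \<le> 2 * ((x\<^sup>2 + y\<^sup>2) / (x + y))"
  proof -
    have "0 \<le> (x - y)\<^sup>2" by simp
    then show ?thesis
      using assms by (simp add: divide_simps power2_eq_square algebra_simps)
  qed
  ultimately have mean_le: "x + y \<le> 2 * q"
    by simp
  then show "D \<le> (x / y + y / x) * (1 / (1 / x + 1 / y))"
    unfolding q_def[symmetric] using assms by linarith
  \<comment> \<open>Here \<open>x + y \<le> 2 * D\<close>, while neither number is below
    \<open>D\<close>.\<close>
  show "x = D \<and> y = D" if "(x / y + y / x) * (1 / (1 / x + 1 / y)) = D"
    using mean_le that[folded q_def] assms by linarith
qed

context simple_graph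
begin

lemma finite_edges: "finite E"
  by (rule finite_subset[of _ "Pow V"]) (use edges finite_vertices in auto)

lemma edge_endpoints:
  assumes "e \<in> E"
  obtains u v where "e = {u, v}" "u \<in> V" "v \<in> V"
  using edges[OF assms] by (auto simp: card_2_iff)

lemma degree_pos_iff: "0 < degree E v \<longleftrightarrow> (\<exists>e\<in>E. v \<in> e)"
  using finite_edges by (auto simp: degree_def card_gt_0_iff)

lemma min_degree_le: "v \<in> V \<Longrightarrow> min_degree V E \<le> degree E v"
  using finite_vertices by (simp add: min_degree_def)

text \<open>The minimum is attained at some vertex as soon as \<open>V\<close> is nonempty; for
  empty \<open>V\<close> both sides hold vacuously.\<close>

lemma regular_iff_degree_eq_min_degree:
  "regular V E \<longleftrightarrow> (\<forall>v\<in>V. degree E v = min_degree V E)"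
proof
  assume reg: "regular V E"
  show "\<forall>v\<in>V. degree E v = min_degree V E"
  proof
    fix v assume "v \<in> V"
    then have "min_degree V E \<in> degree E ` V"
      using finite_vertices unfolding min_degree_def by (intro Min_in) auto
    then obtain w where "w \<in> V" "min_degree V E = degree E w"
      by blast
    then show "degree E v = min_degree V E"
      using reg \<open>v \<in> V\<close> unfolding regular_def by metis
  qed
qed (simp add: regular_def)

end

theorem theorem4:
  fixes V :: "'v set" and E :: "'v set set" and \<alpha> :: real and m :: nat and \<delta> :: nat
  assumes "simple_graph V E"
    and "m = card E" and "m \<ge> 1"
    and "\<delta> = min_degree V E"
    and "\<alpha> > 0"
  shows "SDD \<alpha> E \<ge> real \<delta> powr \<alpha> * (real m)\<^sup>2 / ISD (- \<alpha>) E
    \<and> (SDD \<alpha> E = real \<delta> powr \<alpha> * (real m)\<^sup>2 / ISD (- \<alpha>) E \<longleftrightarrow> regular V E)"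
proof -
  interpret simple_graph V E by fact
  define D where "D = real \<delta> powr \<alpha>"
  define p where "p v = real (degree E v) powr \<alpha>" for v
  define f where "f = edge_value (\<lambda>u v. p u / p v + p v / p u)"
  define g where "g = edge_value (\<lambda>u v. 1 / (1 / p u + 1 / p v))"
  have f_pair: "f {u, v} = p u / p v + p v / p u" for u v
    unfolding f_def by (rule edge_value_pair) simp
  have g_pair: "g {u, v} = 1 / (1 / p u + 1 / p v)" for u v
    unfolding g_def by (rule edge_value_pair) (simp add: add.commute)
  have SDD_eq: "SDD \<alpha> E = sum f E"
    by (simp add: SDD_def f_def p_def)
  have ISD_eq: "ISD (- \<alpha>) E = sum g E"
    by (simp add: ISD_def g_def p_def powr_minus_divide)
  have "E \<noteq> {}"
    using assms by auto
  \<comment> \<open>Membership in an edge matters: \<open>p\<close> vanishes at an isolated vertex,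
    since \<open>0 powr \<alpha> = 0\<close>.\<close>
  have p_pos: "0 < p v" if "e \<in> E" "v \<in> e" for e v
    using degree_pos_iff that by (auto simp: p_def)
  have p_ge: "D \<le> p v" if "v \<in> V" for v
    using min_degree_le[OF that] assms by (auto simp: D_def p_def intro: powr_mono2)
  \<comment> \<open>For \<alpha> > 0 the power is strictly increasing on the nonnegative reals, 0
    included.\<close>
  have p_eq_iff: "p v = D \<longleftrightarrow> degree E v = \<delta>" for v
    using \<open>\<alpha> > 0\<close>
    by (metis D_def p_def linorder_neqE_linordered_idom of_nat_0_le_iff of_nat_eq_iff
        powr_less_mono2 less_irrefl)
  have g_pos: "0 < g e" if e: "e \<in> E" for e
  proof -
    obtain u v where "e = {u, v}"
      using e by (rule edge_endpoints)
    then show ?thesis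
      using p_pos[OF e] by (simp add: g_pair add_pos_pos)
  qed
  have fg: "D \<le> f e * g e" if e: "e \<in> E" for e
  proof -
    obtain u v where "e = {u, v}" "u \<in> V" "v \<in> V"
      using e by (rule edge_endpoints)
    then show ?thesis
      using edge_term_product_bound(1)[of "p u" "p v" D] p_pos[OF e] p_ge
      by (simp add: f_pair g_pair)
  qed
  have fg_eq: "p v = D" if e: "e \<in> E" and "f e * g e = D" "v \<in> e" for e v
  proof -
    obtain x y where "e = {x, y}" "x \<in> V" "y \<in> V"
      using e by (rule edge_endpoints)
    then show ?thesis
      using edge_term_product_bound(2)[of "p x" "p y" D] p_pos[OF e] p_ge that(2,3)
      by (auto simp: f_pair g_pair)
  qed
  have "0 \<le> D" by (simp add: D_def)
  have bound: "D * (real m)\<^sup>2 / sum g E \<le> sum f E"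
    unfolding \<open>m = card E\<close>
    using finite_edges \<open>E \<noteq> {}\<close> g_pos \<open>0 \<le> D\<close> fg by (rule sum_ge_card_squared_div_sum)
  have "sum f E = D * (real m)\<^sup>2 / sum g E \<longleftrightarrow> regular V E"
  proof
    assume "sum f E = D * (real m)\<^sup>2 / sum g E"
    then have tight: "\<forall>e\<in>E. f e * g e = D"
      unfolding \<open>m = card E\<close>
      by (intro sum_ge_card_squared_div_sum(2) finite_edges \<open>E \<noteq> {}\<close> g_pos \<open>0 \<le> D\<close> fg)
    then have deg: "degree E v = \<delta>" if "e \<in> E" "v \<in> e" for e v
      using fg_eq that p_eq_iff by blast
    \<comment> \<open>An endpoint of any edge has degree \<delta>, so \<delta> > 0. Hence no vertex
      is isolated, and the degree condition on edges reaches all of \<open>V\<close>.\<close>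
    obtain e u where "e \<in> E" "u \<in> e"
      using \<open>E \<noteq> {}\<close> by (metis edge_endpoints equals0I insertI1)
    then have "0 < \<delta>"
      using deg degree_pos_iff by metis
    then have "degree E v = \<delta>" if "v \<in> V" for v
      using min_degree_le[OF that] degree_pos_iff deg assms(4)
      by (metis order_less_le_trans)
    then show "regular V E"
      by (simp add: regular_iff_degree_eq_min_degree assms(4))
  next
    assume "regular V E"
    then have p_eq: "p v = D" if "v \<in> V" for v
      using that p_eq_iff by (simp add: regular_iff_degree_eq_min_degree assms(4))
    obtain e u where "e \<in> E" "u \<in> e" "u \<in> V"
      using \<open>E \<noteq> {}\<close> by (metis edge_endpoints equals0I insertI1)
    \<comment> \<open>Some vertex lies on an edge, so the common degree is not 0 and
      \<open>D\<close> may be cancelled below.\<close>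
    then have "0 < D"
      using p_pos p_eq by metis
    have summands: "f e = 2 \<and> g e = D / 2" if e: "e \<in> E" for e
    proof -
      obtain x y where "e = {x, y}" "x \<in> V" "y \<in> V"
        using e by (rule edge_endpoints)
      then show ?thesis
        using p_eq \<open>0 < D\<close> by (simp add: f_pair g_pair)
    qed
    have "sum f E = (\<Sum>e\<in>E. 2)" "sum g E = (\<Sum>e\<in>E. D / 2)"
      using summands by (auto intro!: sum.cong simp del: sum_constant)
    then have "sum f E = 2 * real m" "sum g E = D / 2 * real m"
      using \<open>m = card E\<close> by simp_all
    moreover have "D * (real m)\<^sup>2 / (D / 2 * real m) = 2 * real m"
      using \<open>0 < D\<close> \<open>m \<ge> 1\<close> by (simp add: power2_eq_square)
    ultimately show "sum f E = D * (real m)\<^sup>2 / sum g E"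
      by (simp only:)
  qed
  then show ?thesis
    using bound by (simp add: SDD_eq ISD_eq D_def)
qed

end
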